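(* Let $\mathcal{G}$ be a graph with $p$ nodes, unitary weights, adjacency matrix $\Gamma=(\gamma_{ij})$ and Laplacian $L$, containing at least a directed spanning tree, and let $l^*$ be the maximum diagonal entry of $L$. Consider a fuzzy consensus problem with $p$ discrete-time fuzzy agents interconnected according to $\mathcal{G}$, with fuzzy initial conditions, and let $\tau>0$ be the sampling time. Then both the following statements hold: 1. (Single integrators.) If each agent is a discrete-time single integrator $y_i(k+1)=y_i(k)+\tau e_i(k)$, then for $\tau<1/l^*$ the protocol $e_i(k)=\sum_{j\in\mathcal{N}_i}\gamma_{ij}[y_j(k)-y_i(k)]$, giving the closed loop $y(k+1)=(I_p-\tau L)\,y(k)$, $y(0)=y_0\in\mathbb{E}^p$, solves the problem and the agents reach an agreement: $\lim_{k\to\infty}d_{\mathbb{E}}(y_i(k),y_j(k))=0$ for all $i,j=1,\dots,p$. 2. (Double integrators.) If each agent is a discrete-time double integrator $y_i(k+1)=y_i(k)+\tau v_i(k)+\tau e_{ai}(k)$, $v_i(k+1)=v_i(k)+\tau e_{bi}(k)$, then for $\tau<1/l^*$ the protocol $e_{ai}(k)=\sum_{j\in\mathcal{N}_i}\gamma_{ij}[y_j(k)-y_i(k)]$, $e_{bi}(k)=\sum_{j\in\mathcal{N}_i}\gamma_{ij}[v_j(k)-v_i(k)]$, giving the closed loop $$\begin{bmatrix} y(k+1) \\ {} v(k+1) \end{bmatrix}=\begin{bmatrix} I_p-\tau L & \tau I_p \\ 0 & I_p-\tau L \end{bmatrix}\begin{bmatrix} y(k) \\ {} v(k) \end{bmatrix},\qquad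 y(0)=y_0,\ v(0)=v_0\in\mathbb{E}^p,$$ solves the problem and the agents reach an agreement: $\lim_{k\to\infty}\big[d_{\mathbb{E}}(y_i(k),y_j(k))+d_{\mathbb{E}}(v_i(k),v_j(k))\big]=0$ for all $i,j=1,\dots,p$. Moreover, if $\mathcal{G}$ is also strongly connected and balanced, the average consensus is achieved: in case 1 the consensus value is $\frac1p\sum_j y_{j0}$; in case 2 the consensus values are $\frac1p\sum_j v_{j0}$ for $v$ and $\frac1p\sum_j y_{j0}+k\tau\frac1p\sum_j v_{j0}$ at step $k$ for $y$.
   Context: Graphs: $\mathcal{G}$ has nodes $v_1,\dots,v_p$ and nonnegative adjacency weights $\gamma_{ij}$ (here all weights of edges equal $1$), with $\gamma_{ii}=0$ and $\gamma_{ij}>0$ iff there is an edge $(v_i,v_j)$, i.e. an arc that starts from $v_i$ and reaches $v_j$. The neighbours of node $v_i$ are $\mathcal{N}_i=\{v_j:(v_i,v_j)\text{ is an edge}\}$. The Laplacian is $l_{ii}=\sum_k\gamma_{ik}$, $l_{ij}=-\gamma_{ij}$ for $j\ne i$. $\mathcal{G}$ contains a directed spanning tree if, for some node $v_i$, there is a tree composed of a subset of the oriented edges that connects $v_i$ to each other node $v_j$. $\mathcal{G}$ is strongly connected if for each pair of nodes $v_i,v_j$ there is a path of edges, respecting orientation, connecting $v_i$ and $v_j$; it is balanced if $\sum_j\gamma_{ij}=\sum_j\gamma_{ji}$ for every $i$. Fuzzy numbers: $\mathbb{E}$ is the set of $\mu:\mathbb{R}\to[0,1]$ attaining the value $1$,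 with $[\mu]^\alpha=\{p:\mu(p)\ge\alpha\}$ compact for $\alpha\in(0,1]$, with $[\mu]^0$ (the closure of $\bigcup_{\alpha\in(0,1]}[\mu]^\alpha$) bounded, and with $\mu(\phi p+(1-\phi)q)\ge\min\{\mu(p),\mu(q)\}$ for all $p,q\in\mathbb{R}$, $\phi\in[0,1]$. With $\rho_{\mathbb{R}}$ the Hausdorff metric on nonempty compact subsets of $\mathbb{R}$, $d_{\mathbb{E}}(\mu,\nu)=\sup_{\alpha>0}\rho_{\mathbb{R}}([\mu]^\alpha,[\nu]^\alpha)$. Fuzzy linear maps: for a real matrix $M=(m_{ij})$ and a vector $x$ of elements of $\mathbb{E}$, $Mx$ is the vector of fuzzy numbers with $[(Mx)_i]^\alpha=\{\sum_j m_{ij}z_j: z_j\in[x_j]^\alpha\ \forall j\}$ for all $\alpha\in[0,1]$. Averages of fuzzy numbers are understood in the same sense.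
   Formalization: The directed spanning tree is taken with its arcs oriented towards the root (every node has a directed path to the root); with paths away from the root the claim fails, e.g. for p=3 with arcs (v1,v2),(v1,v3), where agents 2 and 3 never move. If l*=0, τ is unrestricted above. *)

theory Defs
  imports "HOL-Analysis.Analysis"
begin

section \<open>Weighted directed graphs\<close>

text \<open>A graph on the node type \<open>'p\<close> is given by its adjacency matrix; an arc
  \<open>(i, j)\<close> starts at \<open>i\<close> and reaches \<open>j\<close>.\<close>

definition adjacency_matrix :: "real^'p^'p \<Rightarrow> bool" where
  "adjacency_matrix \<Gamma> \<longleftrightarrow> (\<forall>i j. \<Gamma>$i$j \<ge> 0) \<and> (\<forall>i. \<Gamma>$i$i = 0)"

definition edges :: "real^'p^'p \<Rightarrow> ('p \<times> 'p) set" where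
  "edges \<Gamma> = {(i, j). \<Gamma>$i$j > 0}"

definition unitary_weights :: "real^'p^'p \<Rightarrow> bool" where
  "unitary_weights \<Gamma> \<longleftrightarrow> (\<forall>(i, j) \<in> edges \<Gamma>. \<Gamma>$i$j = 1)"

definition neighbours :: "real^'p^'p \<Rightarrow> 'p \<Rightarrow> 'p set" where
  "neighbours \<Gamma> i = {j. (i, j) \<in> edges \<Gamma>}"

definition laplacian :: "real^'p^'p \<Rightarrow> real^'p^'p" where
  "laplacian \<Gamma> = (\<chi> i j. if i = j then (\<Sum>k\<in>UNIV. \<Gamma>$i$k) else - \<Gamma>$i$j)"

definition max_diagonal :: "real^'p^'p \<Rightarrow> real" where
  "max_diagonal A = Max (range (\<lambda>i. A$i$i))"

text \<open>A set of arcs is a spanning tree with root \<open>r\<close> if the root has no outgoing arc, every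
  node has at most one outgoing arc, and every node is joined to \<open>r\<close> by a directed path.
  The paths are oriented towards the root because the protocol makes agent \<open>i\<close> read the state
  of \<open>j\<close> along an arc \<open>(i, j)\<close>: the information of the root then flows, against the arcs,
  to all other nodes. With paths oriented away from the root, the graph with the two arcs
  \<open>(1, 2)\<close> and \<open>(1, 3)\<close> would have a spanning tree, although its agents 2 and 3 never move.\<close>

definition spanning_tree_at :: "('p \<times> 'p) set \<Rightarrow> 'p \<Rightarrow> bool" where
  "spanning_tree_at T r \<longleftrightarrow>
     r \<notin> Domain T \<and> single_valued T \<and> (\<forall>j. (j, r) \<in> T\<^sup>*)"

definition has_directed_spanning_tree :: "real^'p^'p \<Rightarrow> bool" where
  "has_directed_spanning_tree \<Gamma> \<longleftrightarrow> (\<exists>r. \<exists>T \<subseteq> edges \<Gamma>. spanning_tree_at T r)"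

definition strongly_connected :: "real^'p^'p \<Rightarrow> bool" where
  "strongly_connected \<Gamma> \<longleftrightarrow> (\<forall>i j. (i, j) \<in> (edges \<Gamma>)\<^sup>*)"

definition balanced :: "real^'p^'p \<Rightarrow> bool" where
  "balanced \<Gamma> \<longleftrightarrow> (\<forall>i. (\<Sum>j\<in>UNIV. \<Gamma>$i$j) = (\<Sum>j\<in>UNIV. \<Gamma>$j$i))"


section \<open>Fuzzy numbers\<close>

definition level_set :: "(real \<Rightarrow> real) \<Rightarrow> real \<Rightarrow> real set" where
  "level_set \<mu> \<alpha> =
     (if \<alpha> = 0 then closure (\<Union>\<beta>\<in>{0<..1}. {p. \<mu> p \<ge> \<beta>}) else {p. \<mu> p \<ge> \<alpha>})"

typedef fuzzy =
  "{\<mu> :: real \<Rightarrow> real.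
      range \<mu> \<subseteq> {0..1} \<and> (\<exists>p. \<mu> p = 1) \<and>
      (\<forall>\<alpha>\<in>{0<..1}. compact (level_set \<mu> \<alpha>)) \<and> bounded (level_set \<mu> 0) \<and>
      (\<forall>p q. \<forall>\<phi>\<in>{0..1}. \<mu> (\<phi> * p + (1 - \<phi>) * q) \<ge> min (\<mu> p) (\<mu> q))}"
  morphisms membership Fuzzy
proof
  let ?\<mu> = "indicator {0} :: real \<Rightarrow> real"
  have *: "{p. \<beta> \<le> ?\<mu> p} = {0}" if "\<beta> \<in> {0<..1}" for \<beta>
    using that by (auto simp: indicator_def)
  have "level_set ?\<mu> 0 = {0}"
    unfolding level_set_def using * by auto
  then show "?\<mu> \<in> {\<mu>. range \<mu> \<subseteq> {0..1} \<and> (\<exists>p. \<mu> p = 1) \<and>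
      (\<forall>\<alpha>\<in>{0<..1}. compact (level_set \<mu> \<alpha>)) \<and> bounded (level_set \<mu> 0) \<and>
      (\<forall>p q. \<forall>\<phi>\<in>{0..1}. \<mu> (\<phi> * p + (1 - \<phi>) * q) \<ge> min (\<mu> p) (\<mu> q))}"
    using * by (auto simp: level_set_def indicator_def)
qed

definition alpha_cut :: "fuzzy \<Rightarrow> real \<Rightarrow> real set" where
  "alpha_cut x = level_set (membership x)"

definition hausdorff_dist :: "'a::metric_space set \<Rightarrow> 'a set \<Rightarrow> real" where
  "hausdorff_dist A B = max (SUP a\<in>A. infdist a B) (SUP b\<in>B. infdist b A)"

text \<open>The suprema are over bounded sets, since every \<open>alpha_cut x \<alpha>\<close> with \<open>\<alpha> \<in> {0<..1}\<close> is a
  nonempty subset of the bounded set \<open>alpha_cut x 0\<close>.\<close>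

definition fuzzy_dist :: "fuzzy \<Rightarrow> fuzzy \<Rightarrow> real" where
  "fuzzy_dist x y = (SUP \<alpha>\<in>{0<..1}. hausdorff_dist (alpha_cut x \<alpha>) (alpha_cut y \<alpha>))"


section \<open>Fuzzy linear maps\<close>

definition lincomb_cut :: "real^'m \<Rightarrow> fuzzy^'m \<Rightarrow> real \<Rightarrow> real set" where
  "lincomb_cut c x \<alpha> = {\<Sum>j\<in>UNIV. c$j * z$j | z :: real^'m. \<forall>j. z$j \<in> alpha_cut (x$j) \<alpha>}"

text \<open>The description is proper, see \<open>fuzzy_lincomb_ex1\<close> and \<open>alpha_cut_fuzzy_lincomb\<close> below.\<close>

definition fuzzy_lincomb :: "real^'m \<Rightarrow> fuzzy^'m \<Rightarrow> fuzzy" where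
  "fuzzy_lincomb c x = (THE w. \<forall>\<alpha>\<in>{0..1}. alpha_cut w \<alpha> = lincomb_cut c x \<alpha>)"

definition fuzzy_mult :: "real^'m^'n \<Rightarrow> fuzzy^'m \<Rightarrow> fuzzy^'n" where
  "fuzzy_mult M x = (\<chi> i. fuzzy_lincomb (M$i) x)"

definition fuzzy_average :: "fuzzy^'p \<Rightarrow> fuzzy" where
  "fuzzy_average x = fuzzy_lincomb (\<chi> j. 1 / real CARD('p)) x"

lemma alpha_cut_pos: "\<alpha> > 0 \<Longrightarrow> alpha_cut x \<alpha> = {p. membership x p \<ge> \<alpha>}"
  by (simp add: alpha_cut_def level_set_def)

lemma alpha_cut_zero: "alpha_cut x 0 = closure (\<Union>\<beta>\<in>{0<..1}. alpha_cut x \<beta>)"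
proof -
  have "(\<Union>\<beta>\<in>{0<..1}. alpha_cut x \<beta>) = (\<Union>\<beta>\<in>{0<..1}. {p. membership x p \<ge> \<beta>})"
    by (intro SUP_cong) (auto simp: alpha_cut_pos)
  then show ?thesis by (simp add: alpha_cut_def level_set_def)
qed

lemma alpha_cut_antimono:
  assumes "0 \<le> \<alpha>" "\<alpha> \<le> \<beta>" "\<beta> \<le> 1"
  shows "alpha_cut x \<beta> \<subseteq> alpha_cut x \<alpha>"
proof (cases "\<alpha> = 0")
  case True
  show ?thesis
  proof (cases "\<beta> = 0")
    case False
    then have "\<beta> \<in> {0<..1}" using assms by simp
    then have "alpha_cut x \<beta> \<subseteq> (\<Union>\<beta>\<in>{0<..1}. alpha_cut x \<beta>)" by blast
    then show ?thesis
      using True closure_subset[of "\<Union>\<beta>\<in>{0<..1}. alpha_cut x \<beta>"] by (simp add: alpha_cut_zero)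
  qed (simp add: True)
next
  case False
  then show ?thesis using assms by (auto simp: alpha_cut_pos)
qed

lemma alpha_cut_compact:
  assumes "\<alpha> \<in> {0..1}"
  shows "compact (alpha_cut x \<alpha>)"
proof (cases "\<alpha> = 0")
  case True
  have "bounded (alpha_cut x 0)" using membership[of x] by (simp add: alpha_cut_def)
  then show ?thesis using True by (simp add: compact_eq_bounded_closed alpha_cut_zero)
next
  case False
  then show ?thesis using membership[of x] assms by (auto simp: alpha_cut_def)
qed

lemma alpha_cut_convex:
  assumes "\<alpha> \<in> {0..1}"
  shows "convex (alpha_cut x \<alpha>)"
proof -
  have pos: "convex (alpha_cut x \<beta>)" if "\<beta> > 0" for \<beta>
  proof (rule convexI)
    fix p q u v :: real
    assume a: "p \<in> alpha_cut x \<beta>" "q \<in> alpha_cut x \<beta>" "0 \<le> u" "0 \<le> v" "u + v = 1"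
    have v: "v = 1 - u" using a(5) by simp
    have "membership x (u * p + (1 - u) * q) \<ge> min (membership x p) (membership x q)"
      using membership[of x] a(3-5) by auto
    moreover have "min (membership x p) (membership x q) \<ge> \<beta>"
      using a(1,2) that by (simp add: alpha_cut_pos)
    ultimately have "\<beta> \<le> membership x (u * p + (1 - u) * q)" by (rule order_trans[rotated])
    then show "u *\<^sub>R p + v *\<^sub>R q \<in> alpha_cut x \<beta>"
      using that v by (simp add: alpha_cut_pos)
  qed
  have "convex (\<Union>\<beta>\<in>{0<..1}. alpha_cut x \<beta>)"
  proof (rule convexI)
    fix p q u v :: real
    assume a: "p \<in> (\<Union>\<beta>\<in>{0<..1}. alpha_cut x \<beta>)" "q \<in> (\<Union>\<beta>\<in>{0<..1}. alpha_cut x \<beta>)"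
      "0 \<le> u" "0 \<le> v" "u + v = 1"
    then obtain b1 b2 where b: "b1 \<in> {0<..1}" "b2 \<in> {0<..1}" "p \<in> alpha_cut x b1" "q \<in> alpha_cut x b2"
      by blast
    define b where "b = min b1 b2"
    have b': "b \<in> {0<..1}" using b by (auto simp: b_def)
    have "alpha_cut x b1 \<subseteq> alpha_cut x b" "alpha_cut x b2 \<subseteq> alpha_cut x b"
      using b b' by (intro alpha_cut_antimono; simp add: b_def)+
    then have "u *\<^sub>R p + v *\<^sub>R q \<in> alpha_cut x b"
      using b b' a(3-5) by (intro convexD[OF pos]) auto
    then show "u *\<^sub>R p + v *\<^sub>R q \<in> (\<Union>\<beta>\<in>{0<..1}. alpha_cut x \<beta>)" using b' by blast
  qed
  then have "convex (alpha_cut x 0)" by (simp add: alpha_cut_zero convex_closure)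
  then show ?thesis using pos assms by (cases "\<alpha> = 0") auto
qed

lemma alpha_cut_nonempty:
  assumes "\<alpha> \<in> {0..1}"
  shows "alpha_cut x \<alpha> \<noteq> {}"
proof -
  obtain p where "membership x p = 1" using membership[of x] by auto
  then have "p \<in> alpha_cut x 1" by (simp add: alpha_cut_pos)
  then show ?thesis using alpha_cut_antimono[of \<alpha> 1 x] assms by auto
qed

lemma fuzzy_eqI:
  assumes "\<And>\<alpha>. \<alpha> \<in> {0<..1} \<Longrightarrow> alpha_cut x \<alpha> = alpha_cut y \<alpha>"
  shows "x = y"
proof -
  have rng: "membership w p \<in> {0..1}" for w p
    using membership[of w] by blast
  have le: "membership u p \<le> membership w p"
    if "\<And>\<alpha>. \<alpha> \<in> {0<..1} \<Longrightarrow> alpha_cut u \<alpha> = alpha_cut w \<alpha>" for u w p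
  proof (cases "membership u p = 0")
    case True
    then show ?thesis using rng[of w p] by simp
  next
    case False
    then have "membership u p \<in> {0<..1}" using rng[of u p] by auto
    then show ?thesis using that[of "membership u p"] by (auto simp: alpha_cut_pos)
  qed
  have "membership x = membership y"
    by (intro ext antisym le) (use assms in auto)
  then show ?thesis by (simp add: membership_inject)
qed

lemma ex_fuzzy_of_cuts:
  fixes A :: "real \<Rightarrow> real set"
  assumes comp: "\<And>\<alpha>. \<alpha> \<in> {0..1} \<Longrightarrow> compact (A \<alpha>)"
    and conv: "\<And>\<alpha>. \<alpha> \<in> {0<..1} \<Longrightarrow> convex (A \<alpha>)"
    and ne: "A 1 \<noteq> {}"
    and mono: "\<And>\<alpha> \<beta>. 0 \<le> \<alpha> \<Longrightarrow> \<alpha> \<le> \<beta> \<Longrightarrow> \<beta> \<le> 1 \<Longrightarrow> A \<beta> \<subseteq> A \<alpha>"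
    and left: "\<And>\<alpha> r. \<alpha> \<in> {0<..1} \<Longrightarrow> (\<And>\<beta>. 0 < \<beta> \<Longrightarrow> \<beta> < \<alpha> \<Longrightarrow> r \<in> A \<beta>) \<Longrightarrow> r \<in> A \<alpha>"
    and zero: "A 0 = closure (\<Union>\<beta>\<in>{0<..1}. A \<beta>)"
  shows "\<exists>w. \<forall>\<alpha>\<in>{0..1}. alpha_cut w \<alpha> = A \<alpha>"
proof -
  define S where "S r = insert 0 {\<alpha>\<in>{0<..1}. r \<in> A \<alpha>}" for r
  define \<mu> where "\<mu> r = Sup (S r)" for r
  have bdd: "bdd_above (S r)" for r
    by (rule bdd_aboveI[of _ 1]) (auto simp: S_def)
  have mu0: "0 \<le> \<mu> r" for r
    unfolding \<mu>_def by (rule cSup_upper[OF _ bdd]) (simp add: S_def)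
  have mu1: "\<mu> r \<le> 1" for r
    unfolding \<mu>_def by (rule cSup_least) (auto simp: S_def)
  have iff: "\<mu> r \<ge> \<alpha> \<longleftrightarrow> r \<in> A \<alpha>" if \<alpha>: "\<alpha> \<in> {0<..1}" for \<alpha> r
  proof
    assume "r \<in> A \<alpha>"
    then show "\<mu> r \<ge> \<alpha>"
      unfolding \<mu>_def by (intro cSup_upper[OF _ bdd]) (use \<alpha> in \<open>auto simp: S_def\<close>)
  next
    assume ge: "\<mu> r \<ge> \<alpha>"
    show "r \<in> A \<alpha>"
    proof (rule left[OF \<alpha>])
      fix \<beta> :: real assume b: "0 < \<beta>" "\<beta> < \<alpha>"
      then have "\<beta> < Sup (S r)" using ge by (simp add: \<mu>_def)
      then obtain \<gamma> where g: "\<gamma> \<in> S r" "\<beta> < \<gamma>"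
        using less_cSup_iff[OF _ bdd, of r \<beta>] by (auto simp: S_def)
      then have "r \<in> A \<gamma>" "\<gamma> \<le> 1" using b by (auto simp: S_def)
      then show "r \<in> A \<beta>" using mono[of \<beta> \<gamma>] b g by auto
    qed
  qed
  have lev: "level_set \<mu> \<alpha> = A \<alpha>" if "\<alpha> \<in> {0<..1}" for \<alpha>
    using that iff by (auto simp: level_set_def)
  have "(\<Union>\<beta>\<in>{0<..1}. {p. \<mu> p \<ge> \<beta>}) = (\<Union>\<beta>\<in>{0<..1}. A \<beta>)"
    by (intro SUP_cong) (auto simp: iff)
  then have lev0: "level_set \<mu> 0 = A 0"
    by (simp add: level_set_def zero)
  have one: "\<exists>p. \<mu> p = 1"
    using ne iff[of 1] mu1 by (auto intro: antisym)
  have qc: "min (\<mu> p) (\<mu> q) \<le> \<mu> (\<phi> * p + (1 - \<phi>) * q)" if "\<phi> \<in> {0..1}" for p q \<phi>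
  proof (cases "min (\<mu> p) (\<mu> q) = 0")
    case True
    then show ?thesis using mu0 by simp
  next
    case False
    define m where "m = min (\<mu> p) (\<mu> q)"
    have m: "m \<in> {0<..1}"
      using False mu0[of p] mu0[of q] mu1[of p] mu1[of q] unfolding m_def min_def
      by (auto split: if_splits)
    have "m \<le> \<mu> p" "m \<le> \<mu> q" by (simp_all add: m_def)
    then have "p \<in> A m" "q \<in> A m" by (simp_all only: iff[OF m])
    then have "\<phi> *\<^sub>R p + (1 - \<phi>) *\<^sub>R q \<in> A m"
      using that by (intro convexD[OF conv[OF m]]) auto
    then have "m \<le> \<mu> (\<phi> * p + (1 - \<phi>) * q)"
      by (simp only: iff[OF m] real_scaleR_def)
    then show ?thesis by (simp add: m_def)
  qed
  have "bounded (A 0)" using comp[of 0] by (simp add: compact_imp_bounded)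
  have "membership (Fuzzy \<mu>) = \<mu>"
  proof (intro Fuzzy_inverse CollectI conjI)
    show "range \<mu> \<subseteq> {0..1}" using mu0 mu1 by auto
    show "\<forall>\<alpha>\<in>{0<..1}. compact (level_set \<mu> \<alpha>)" using lev comp by simp
    show "bounded (level_set \<mu> 0)" using lev0 \<open>bounded (A 0)\<close> by simp
  qed (use one qc in blast)+
  then have "alpha_cut (Fuzzy \<mu>) \<alpha> = A \<alpha>" if "\<alpha> \<in> {0..1}" for \<alpha>
    using that lev lev0 by (cases "\<alpha> = 0") (auto simp: alpha_cut_def)
  then show ?thesis by blast
qed

lemma fuzzy_lincomb_ex1:
  fixes c :: "real^'m" and x :: "fuzzy^'m"
  shows "\<exists>!w. \<forall>\<alpha>\<in>{0..1}. alpha_cut w \<alpha> = lincomb_cut c x \<alpha>"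
proof -
  define f where "f z = (\<Sum>j\<in>UNIV. c$j * z$j)" for z :: "real^'m"
  define K where "K \<alpha> = {z :: real^'m. \<forall>j. z$j \<in> alpha_cut (x$j) \<alpha>}" for \<alpha>
  have cutf: "lincomb_cut c x \<alpha> = f ` K \<alpha>" for \<alpha>
    by (auto simp: lincomb_cut_def f_def K_def)
  have fc: "continuous_on X f" for X
    unfolding f_def by (intro continuous_intros)
  have fl: "linear f"
    unfolding f_def
    by (intro linearI) (simp_all add: algebra_simps sum.distrib sum_distrib_left)
  have Kconv: "convex (K \<alpha>)" if "\<alpha> \<in> {0..1}" for \<alpha>
  proof (rule convexI)
    fix y z :: "real^'m" and u v :: real
    assume "y \<in> K \<alpha>" "z \<in> K \<alpha>" "0 \<le> u" "0 \<le> v" "u + v = 1"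
    then show "u *\<^sub>R y + v *\<^sub>R z \<in> K \<alpha>"
      using convexD[OF alpha_cut_convex[OF that]] by (fastforce simp: K_def)
  qed
  have Kcomp: "compact (K \<alpha>)" if a: "\<alpha> \<in> {0..1}" for \<alpha>
  proof -
    have eq: "K \<alpha> = (\<Inter>j. (\<lambda>z. z$j) -` alpha_cut (x$j) \<alpha>)"
      by (auto simp: K_def)
    have "closed ((\<lambda>z::real^'m. z$j) -` alpha_cut (x$j) \<alpha>)" for j
      using alpha_cut_compact[OF a] by (intro closed_vimage compact_imp_closed continuous_intros)
    then have "closed (K \<alpha>)" unfolding eq by (intro closed_INT) auto
    moreover have "bounded (K \<alpha>)"
    proof -
      have "\<forall>j. \<exists>B. \<forall>p\<in>alpha_cut (x$j) \<alpha>. \<bar>p\<bar> \<le> B"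
        using compact_imp_bounded[OF alpha_cut_compact[OF a]] by (simp add: bounded_iff)
      then obtain B where B: "\<And>j p. p \<in> alpha_cut (x$j) \<alpha> \<Longrightarrow> \<bar>p\<bar> \<le> B j" by metis
      have "norm z \<le> (\<Sum>j\<in>UNIV. B j)" if "z \<in> K \<alpha>" for z
      proof -
        have "norm z \<le> (\<Sum>j\<in>UNIV. \<bar>z$j\<bar>)" by (rule norm_le_l1_cart)
        also have "\<dots> \<le> (\<Sum>j\<in>UNIV. B j)"
          using that by (intro sum_mono B) (simp add: K_def)
        finally show ?thesis .
      qed
      then show ?thesis by (auto simp: bounded_iff)
    qed
    ultimately show ?thesis by (simp add: compact_eq_bounded_closed)
  qed
  have Kne: "K \<alpha> \<noteq> {}" if "\<alpha> \<in> {0..1}" for \<alpha>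
  proof -
    have "\<forall>j. \<exists>p. p \<in> alpha_cut (x$j) \<alpha>" using alpha_cut_nonempty[OF that] by blast
    then obtain g where "\<And>j. g j \<in> alpha_cut (x$j) \<alpha>" by metis
    then have "(\<chi> j. g j) \<in> K \<alpha>" by (simp add: K_def)
    then show ?thesis by blast
  qed
  have Kmono: "K \<beta> \<subseteq> K \<alpha>" if "0 \<le> \<alpha>" "\<alpha> \<le> \<beta>" "\<beta> \<le> 1" for \<alpha> \<beta>
    using alpha_cut_antimono[OF that] by (auto simp: K_def)
  have left: "r \<in> f ` K \<alpha>"
    if a: "\<alpha> \<in> {0<..1}" and r: "\<And>\<beta>. 0 < \<beta> \<Longrightarrow> \<beta> < \<alpha> \<Longrightarrow> r \<in> f ` K \<beta>" for \<alpha> r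
  proof -
    define b where "b n = \<alpha> * (1 - 1 / real (n + 2))" for n :: nat
    have b: "0 < b n" "b n < \<alpha>" for n
    proof -
      have "0 < 1 - 1 / real (n + 2)" "1 - 1 / real (n + 2) < 1" by (simp_all add: field_simps)
      then show "0 < b n" "b n < \<alpha>" using a by (simp_all add: b_def)
    qed
    have bm: "b m \<le> b n" if "m \<le> n" for m n
      using a that unfolding b_def by (intro mult_left_mono diff_left_mono divide_left_mono) auto
    have blim: "b \<longlonglongrightarrow> \<alpha>"
    proof -
      have "(\<lambda>n. 1 / real (n + 2)) \<longlonglongrightarrow> 0"
        using LIMSEQ_ignore_initial_segment[OF lim_1_over_n, of 2] by simp
      then have "(\<lambda>n. \<alpha> * (1 - 1 / real (n + 2))) \<longlonglongrightarrow> \<alpha> * (1 - 0)"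
        by (intro tendsto_intros)
      then show ?thesis by (simp add: b_def[abs_def])
    qed
    define F where "F n = K (b n) \<inter> f -` {r}" for n
    have "(\<Inter>n. F n) \<noteq> {}"
    proof (rule compact_nest)
      fix n
      have "b n \<in> {0..1}" using b[of n] a by auto
      then show "compact (F n)"
        unfolding F_def
        by (intro compact_Int_closed Kcomp closed_vimage fc) auto
      show "F n \<noteq> {}" using r[of "b n"] b[of n] by (auto simp: F_def)
    next
      fix m n :: nat assume "m \<le> n"
      moreover have "0 \<le> b m" "b n \<le> 1" using b[of m] b[of n] a by auto
      ultimately show "F n \<subseteq> F m"
        using Kmono[of "b m" "b n"] bm[of m n] by (auto simp: F_def)
    qed
    then obtain z where z: "\<And>n. z \<in> K (b n)" "f z = r" by (auto simp: F_def)
    have "membership (x$j) (z$j) \<ge> \<alpha>" for j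
    proof (rule LIMSEQ_le_const2[OF blim], intro exI allI impI)
      fix n :: nat
      show "b n \<le> membership (x$j) (z$j)"
        using z(1)[of n] b[of n] by (auto simp: K_def alpha_cut_pos)
    qed
    then have "z \<in> K \<alpha>" using a by (auto simp: K_def alpha_cut_pos)
    then show ?thesis using z(2) by blast
  qed
  have K0: "K 0 \<subseteq> closure (\<Union>\<beta>\<in>{0<..1}. K \<beta>)"
  proof
    fix z assume z: "z \<in> K 0"
    show "z \<in> closure (\<Union>\<beta>\<in>{0<..1}. K \<beta>)"
      unfolding closure_approachable
    proof (intro allI impI)
      fix e :: real assume e: "e > 0"
      define d where "d = e / (2 * real CARD('m))"
      have d: "d > 0" using e by (simp add: d_def)
      have "\<forall>j. \<exists>w \<beta>. \<beta> \<in> {0<..1} \<and> w \<in> alpha_cut (x$j) \<beta> \<and> dist w (z$j) < d"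
      proof
        fix j
        have "z$j \<in> closure (\<Union>\<beta>\<in>{0<..1}. alpha_cut (x$j) \<beta>)"
          using z by (auto simp: K_def alpha_cut_zero)
        then show "\<exists>w \<beta>. \<beta> \<in> {0<..1} \<and> w \<in> alpha_cut (x$j) \<beta> \<and> dist w (z$j) < d"
          using d unfolding closure_approachable by blast
      qed
      then obtain w \<beta> where w: "\<And>j. \<beta> j \<in> {0<..1}" "\<And>j. w j \<in> alpha_cut (x$j) (\<beta> j)"
          "\<And>j. dist (w j) (z$j) < d" by metis
      define b where "b = Min (range \<beta>)"
      have "b \<in> range \<beta>" unfolding b_def by (intro Min_in) auto
      then have b: "b \<in> {0<..1}" using w(1) by auto
      have "b \<le> \<beta> j" for j unfolding b_def by simp
      then have "w j \<in> alpha_cut (x$j) b" for j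
        using w(1,2)[of j] b alpha_cut_antimono[of b "\<beta> j" "x$j"] by auto
      then have wK: "(\<chi> j. w j) \<in> K b" by (simp add: K_def)
      have "dist (\<chi> j. w j) z \<le> (\<Sum>j\<in>UNIV. \<bar>((\<chi> j. w j) - z)$j\<bar>)"
        unfolding dist_norm by (rule norm_le_l1_cart)
      also have "\<dots> \<le> (\<Sum>j\<in>(UNIV::'m set). d)"
        using w(3) by (intro sum_mono) (auto simp: dist_real_def less_imp_le)
      also have "\<dots> < e" using e by (simp add: d_def)
      finally show "\<exists>y\<in>\<Union>\<beta>\<in>{0<..1}. K \<beta>. dist y z < e" using wK b by blast
    qed
  qed
  have zero: "f ` K 0 = closure (\<Union>\<beta>\<in>{0<..1}. f ` K \<beta>)"
  proof
    have "f ` K 0 \<subseteq> f ` closure (\<Union>\<beta>\<in>{0<..1}. K \<beta>)" using K0 by blast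
    also have "\<dots> \<subseteq> closure (f ` (\<Union>\<beta>\<in>{0<..1}. K \<beta>))"
      by (rule image_closure_subset[OF fc closed_closure closure_subset])
    finally show "f ` K 0 \<subseteq> closure (\<Union>\<beta>\<in>{0<..1}. f ` K \<beta>)" by (simp add: image_UN)
    have "closed (f ` K 0)"
      by (intro compact_imp_closed compact_continuous_image fc Kcomp) auto
    moreover have "(\<Union>\<beta>\<in>{0<..1}. f ` K \<beta>) \<subseteq> f ` K 0"
      by (intro UN_least image_mono Kmono) auto
    ultimately show "closure (\<Union>\<beta>\<in>{0<..1}. f ` K \<beta>) \<subseteq> f ` K 0"
      by (rule closure_minimal[rotated])
  qed
  have "\<exists>w. \<forall>\<alpha>\<in>{0..1}. alpha_cut w \<alpha> = f ` K \<alpha>"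
  proof (rule ex_fuzzy_of_cuts)
    show "compact (f ` K \<alpha>)" if "\<alpha> \<in> {0..1}" for \<alpha>
      by (intro compact_continuous_image fc Kcomp that)
    show "convex (f ` K \<alpha>)" if "\<alpha> \<in> {0<..1}" for \<alpha>
      using that by (intro convex_linear_image fl Kconv) auto
    show "f ` K 1 \<noteq> {}" using Kne[of 1] by simp
    show "f ` K \<beta> \<subseteq> f ` K \<alpha>" if "0 \<le> \<alpha>" "\<alpha> \<le> \<beta>" "\<beta> \<le> 1" for \<alpha> \<beta>
      using Kmono[OF that] by blast
  qed (use left zero in auto)
  then obtain w where w: "\<forall>\<alpha>\<in>{0..1}. alpha_cut w \<alpha> = lincomb_cut c x \<alpha>"
    by (auto simp: cutf)
  show ?thesis
  proof (rule ex1I[of _ w])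
    fix w' assume "\<forall>\<alpha>\<in>{0..1}. alpha_cut w' \<alpha> = lincomb_cut c x \<alpha>"
    then show "w' = w" using w by (intro fuzzy_eqI) auto
  qed (rule w)
qed

lemma alpha_cut_fuzzy_lincomb:
  "\<alpha> \<in> {0..1} \<Longrightarrow> alpha_cut (fuzzy_lincomb c x) \<alpha> = lincomb_cut c x \<alpha>"
  unfolding fuzzy_lincomb_def using theI'[OF fuzzy_lincomb_ex1[of c x]] by blast


section \<open>Agents, protocol and block notation\<close>

text \<open>The agents and the protocol are given by their crisp input-output laws. A fuzzy difference
  \<open>y\<^sub>j - y\<^sub>i\<close> is not formed separately: the fuzzy closed loop is the fuzzy linear map of
  the resulting closed-loop matrix.\<close>

definition consensus_protocol :: "real^'p^'p \<Rightarrow> real^'p \<Rightarrow> real^'p" where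
  "consensus_protocol \<Gamma> y = (\<chi> i. \<Sum>j\<in>neighbours \<Gamma> i. \<Gamma>$i$j * (y$j - y$i))"

definition single_integrator :: "real \<Rightarrow> real^'p \<Rightarrow> real^'p \<Rightarrow> real^'p" where
  "single_integrator \<tau> y e = (\<chi> i. y$i + \<tau> * e$i)"

definition stack :: "'a^'m \<Rightarrow> 'a^'n \<Rightarrow> 'a^('m + 'n)" where
  "stack u w = (\<chi> s. case s of Inl i \<Rightarrow> u$i | Inr j \<Rightarrow> w$j)"

definition double_integrator ::
  "real \<Rightarrow> real^'p \<Rightarrow> real^'p \<Rightarrow> real^'p \<Rightarrow> real^'p \<Rightarrow> real^('p + 'p)" where
  "double_integrator \<tau> y v ea eb =
     stack (\<chi> i. y$i + \<tau> * v$i + \<tau> * ea$i) (\<chi> i. v$i + \<tau> * eb$i)"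

definition block_matrix ::
  "'a^'m^'m \<Rightarrow> 'a^'n^'m \<Rightarrow> 'a^'m^'n \<Rightarrow> 'a^'n^'n \<Rightarrow> 'a^('m + 'n)^('m + 'n)" where
  "block_matrix A B C D =
     (\<chi> s. case s of Inl i \<Rightarrow> stack (A$i) (B$i) | Inr j \<Rightarrow> stack (C$j) (D$j))"

definition single_loop_matrix :: "real \<Rightarrow> real^'p^'p \<Rightarrow> real^'p^'p" where
  "single_loop_matrix \<tau> \<Gamma> = mat 1 - \<tau> *\<^sub>R laplacian \<Gamma>"

definition double_loop_matrix :: "real \<Rightarrow> real^'p^'p \<Rightarrow> real^('p + 'p)^('p + 'p)" where
  "double_loop_matrix \<tau> \<Gamma> =
     block_matrix (mat 1 - \<tau> *\<^sub>R laplacian \<Gamma>) (\<tau> *\<^sub>R mat 1)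
                  0 (mat 1 - \<tau> *\<^sub>R laplacian \<Gamma>)"

text \<open>The fuzzy number \<open>(1/p) \<Sum>\<^sub>j y\<^sub>j + t (1/p) \<Sum>\<^sub>j v\<^sub>j\<close>, as one linear map of
  the \<open>2 p\<close> fuzzy numbers \<open>y\<^sub>1, \<dots>, y\<^sub>p, v\<^sub>1, \<dots>, v\<^sub>p\<close>.\<close>

definition fuzzy_drift_average :: "real \<Rightarrow> fuzzy^'p \<Rightarrow> fuzzy^'p \<Rightarrow> fuzzy" where
  "fuzzy_drift_average t y v =
     fuzzy_lincomb (stack (\<chi> j. 1 / real CARD('p)) (\<chi> j. t * (1 / real CARD('p)))) (stack y v)"

end

theory Submission
  imports Defs
begin

text \<open>The bound on \<open>\<tau>\<close> makes \<open>A = I - \<tau> L\<close> row stochastic with positive diagonal. A fuzzy linear map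
  with nonnegative coefficients acts on the lower and on the upper endpoints of each alpha-cut as
  the crisp matrix, so both closed loops reduce to crisp recursions, with bounds uniform in
  \<open>\<alpha>\<close>. Since every node reaches the root \<open>r\<close> and loops are available, some power \<open>A\<^sup>N\<close> has its whole
  column \<open>r\<close> bounded below by a \<open>\<delta> > 0\<close>, and it shrinks the spread of a vector by the factor
  \<open>1 - \<delta>\<close>. The spread of \<open>A\<^sup>k x\<close> thus decays geometrically, fast enough to absorb the factor \<open>k\<close>
  in the solution \<open>y(k) = A\<^sup>k y(0) + k \<tau> A\<^bsup>k-1\<^esup> v(0)\<close> of the double integrator. Balance makes \<open>A\<close>
  column stochastic, hence average preserving.\<close>

section \<open>Stochastic matrices\<close>

definition row_stochastic :: "real^'p^'p \<Rightarrow> bool" where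
  "row_stochastic A \<longleftrightarrow> (\<forall>i j. A$i$j \<ge> 0) \<and> (\<forall>i. (\<Sum>j\<in>UNIV. A$i$j) = 1)"

definition iter :: "real^'p^'p \<Rightarrow> nat \<Rightarrow> real^'p \<Rightarrow> real^'p" where
  "iter A k = ((*v) A) ^^ k"

lemma iter_0 [simp]: "iter A 0 x = x"
  by (simp add: iter_def)

lemma iter_Suc: "iter A (Suc k) x = A *v iter A k x"
  by (simp add: iter_def)

lemma iter_add: "iter A (m + n) x = iter A m (iter A n x)"
  by (simp add: iter_def funpow_add)

lemma iter_diff: "iter A k (x - y) = iter A k x - iter A k y"
  by (induction k) (simp_all add: iter_Suc matrix_vector_mult_diff_distrib)

text \<open>Each row sums to 1, so constants are fixed. Together with \<open>iter_diff\<close> this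
  lets bounds for nonnegative vectors be applied to \<open>x - m\<close> and
  \<open>M - x\<close>.\<close>

lemma iter_const:
  assumes "row_stochastic A"
  shows "iter A k (\<chi> i. c) = (\<chi> i. c)"
  using assms
  by (induction k)
    (simp_all add: iter_Suc row_stochastic_def matrix_vector_mult_def vec_eq_iff
      flip: sum_distrib_right)

lemma iter_nonneg:
  assumes "row_stochastic A" "\<And>i. x$i \<ge> 0"
  shows "iter A k x $ i \<ge> 0"
  using assms
  by (induction k arbitrary: i)
    (auto simp: iter_Suc row_stochastic_def matrix_vector_mult_def intro!: sum_nonneg)

text \<open>Summing over the rows first replaces each column of \<open>A\<close> by its sum 1. For
  balanced graphs this becomes conservation of the average.\<close>

lemma sum_iter_column_stochastic:
  fixes A :: "real^'p^'p"
  assumes "\<And>j. (\<Sum>i\<in>UNIV. A$i$j) = 1"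
  shows "(\<Sum>i\<in>UNIV. iter A k x $ i) = (\<Sum>i\<in>UNIV. x$i)"
proof (induction k)
  case (Suc k)
  have "(\<Sum>i\<in>UNIV. iter A (Suc k) x $ i) = (\<Sum>j\<in>UNIV. (\<Sum>i\<in>UNIV. A$i$j) * iter A k x $ j)"
    unfolding iter_Suc matrix_vector_mult_def sum_distrib_right
    by (simp, rule sum.swap)
  then show ?case using Suc assms by simp
qed simp

lemma iter_between:
  assumes A: "row_stochastic A" and x: "\<And>i. m \<le> x$i" "\<And>i. x$i \<le> M"
  shows "m \<le> iter A k x $ i" "iter A k x $ i \<le> M"
  using iter_nonneg[OF A, of "x - (\<chi> i. m)" k i] iter_nonneg[OF A, of "(\<chi> i. M) - x" k i] x
  by (simp_all add: iter_diff iter_const[OF A])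

section \<open>Lower bounds along paths and contraction of the spread\<close>

text \<open>Induction along the path: an arc \<open>(i, j)\<close> costs one step and a factor
  \<open>A$i$j\<close>, and the loop at \<open>r\<close> allows waiting there for any number of
  steps. Stating the bound for all \<open>k \<ge> n\<close> is what later allows one common exponent
  for all nodes.\<close>

lemma iter_ge_root:
  fixes A :: "real^'p^'p"
  assumes A: "row_stochastic A" and diag: "\<And>i. A$i$i > 0"
    and path: "(i, r) \<in> {(i, j). A$i$j > 0}\<^sup>*"
  shows "\<exists>n. \<forall>k\<ge>n. \<exists>\<delta>>0. \<forall>x. (\<forall>j. x$j \<ge> 0) \<longrightarrow> iter A k x $ i \<ge> \<delta> * x$r"
proof -
  have entry: "iter A (Suc k) x $ i \<ge> A$i$j * iter A k x $ j" if "\<And>j. x$j \<ge> 0" for k and x :: "real^'p" and i j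
    unfolding iter_Suc matrix_vector_mult_def vec_lambda_beta
    using A iter_nonneg[OF A that]
    by (intro member_le_sum) (auto simp: row_stochastic_def that)
  show ?thesis
    using path
  proof (induction rule: converse_rtrancl_induct)
    case base
    have "iter A k x $ r \<ge> (A$r$r) ^ k * x$r" if "\<And>j. x$j \<ge> 0" for k and x :: "real^'p"
    proof (induction k)
      case (Suc k)
      then have "A$r$r * (A$r$r ^ k * x$r) \<le> A$r$r * iter A k x $ r"
        using diag[of r] by (intro mult_left_mono) auto
      then show ?case using entry[where x = x and i = r and j = r and k = k] that by (simp add: mult.assoc)
    qed simp
    then show ?case using diag[of r] by (intro exI[of _ 0]) (meson zero_less_power)
  next
    case (step i j)
    then have a: "A$i$j > 0" by simp
    from step obtain n where
      n: "\<And>k. k \<ge> n \<Longrightarrow> \<exists>\<delta>>0. \<forall>x. (\<forall>j. x$j \<ge> 0) \<longrightarrow> iter A k x $ j \<ge> \<delta> * x$r" by blast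
    show ?case
    proof (intro exI[of _ "Suc n"] allI impI)
      fix k assume "k \<ge> Suc n"
      then obtain k' where k: "k = Suc k'" "k' \<ge> n" by (cases k) auto
      then obtain \<delta> where d: "\<delta> > 0" "\<And>x. (\<forall>j. x$j \<ge> 0) \<Longrightarrow> iter A k' x $ j \<ge> \<delta> * x$r"
        using n by blast
      have "iter A k x $ i \<ge> (A$i$j * \<delta>) * x$r" if "\<forall>j. x$j \<ge> 0" for x
      proof -
        have "A$i$j * (\<delta> * x$r) \<le> A$i$j * iter A k' x $ j"
          using a d(2)[OF that] by (intro mult_left_mono) auto
        also have "\<dots> \<le> iter A k x $ i"
          using entry that by (simp add: k(1))
        finally show ?thesis by (simp add: mult.assoc)
      qed
      then show "\<exists>\<delta>>0. \<forall>x. (\<forall>j. x$j \<ge> 0) \<longrightarrow> iter A k x $ i \<ge> \<delta> * x$r"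
        using a d(1) by (intro exI[of _ "A$i$j * \<delta>"]) simp
    qed
  qed
qed

text \<open>With finitely many nodes, the largest threshold and the smallest constant serve all of
  them. \<open>Suc\<close> secures \<open>N > 0\<close>, and cutting off at 1 keeps
  \<open>1 - \<delta>\<close> nonnegative for the later contraction.\<close>

lemma iter_ge_root_uniform:
  fixes A :: "real^'p^'p"
  assumes A: "row_stochastic A" and diag: "\<And>i. A$i$i > 0"
    and path: "\<And>i. (i, r) \<in> {(i, j). A$i$j > 0}\<^sup>*"
  obtains N \<delta> where "N > 0" "0 < \<delta>" "\<delta> \<le> 1"
    "\<And>x i. (\<And>j. x$j \<ge> 0) \<Longrightarrow> iter A N x $ i \<ge> \<delta> * x$r"
proof -
  have "\<forall>i. \<exists>n. \<forall>k\<ge>n. \<exists>\<delta>>0. \<forall>x. (\<forall>j. x$j \<ge> 0) \<longrightarrow> iter A k x $ i \<ge> \<delta> * x$r"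
    using iter_ge_root[OF A diag path] by blast
  then obtain n where n: "\<And>i k. k \<ge> n i \<Longrightarrow>
      \<exists>\<delta>>0. \<forall>x. (\<forall>j. x$j \<ge> 0) \<longrightarrow> iter A k x $ i \<ge> \<delta> * x$r" by metis
  define N where "N = Suc (Max (range n))"
  have "N \<ge> n i" for i unfolding N_def by (simp add: le_SucI)
  then have "\<forall>i. \<exists>\<delta>>0. \<forall>x. (\<forall>j. x$j \<ge> 0) \<longrightarrow> iter A N x $ i \<ge> \<delta> * x$r"
    using n by blast
  then obtain d where d: "\<And>i. d i > 0"
      "\<And>i x. (\<forall>j. x$j \<ge> 0) \<Longrightarrow> iter A N x $ i \<ge> d i * x$r" by metis
  define \<delta> where "\<delta> = min 1 (Min (range d))"
  have "Min (range d) \<in> range d" by (intro Min_in) auto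
  then have pos: "\<delta> > 0" using d(1) by (auto simp: \<delta>_def)
  have le: "\<delta> \<le> d i" for i
  proof -
    have "Min (range d) \<le> d i" by simp
    then show ?thesis unfolding \<delta>_def by linarith
  qed
  show thesis
  proof
    fix x :: "real^'p" and i assume x: "\<And>j. x$j \<ge> 0"
    have "\<delta> * x$r \<le> d i * x$r" using le x by (intro mult_right_mono)
    then show "iter A N x $ i \<ge> \<delta> * x$r" using d(2)[of x i] x by simp
  qed (use pos in \<open>auto simp: N_def \<delta>_def\<close>)
qed

text \<open>\<open>f\<close> depends on neither \<open>x\<close> nor \<open>R\<close>, so one rate
  serves the endpoint vectors of all \<alpha>. The second limit is for the drift term of the double
  integrator, whose spread carries the factor \<open>k\<close>.\<close>

lemma iter_spread_tendsto_0:
  fixes A :: "real^'p^'p"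
  assumes A: "row_stochastic A" and diag: "\<And>i. A$i$i > 0"
    and path: "\<And>i. (i, r) \<in> {(i, j). A$i$j > 0}\<^sup>*"
  obtains f :: "nat \<Rightarrow> real" where "f \<longlonglongrightarrow> 0" "(\<lambda>k. real k * f (k - 1)) \<longlonglongrightarrow> 0"
    "\<And>x R k i j. (\<And>i. \<bar>x$i\<bar> \<le> R) \<Longrightarrow> \<bar>iter A k x $ i - iter A k x $ j\<bar> \<le> R * f k"
proof -
  obtain N \<delta> where N: "N > 0" and \<delta>: "0 < \<delta>" "\<delta> \<le> 1"
    and root: "\<And>x i. (\<And>j. x$j \<ge> 0) \<Longrightarrow> iter A N x $ i \<ge> \<delta> * x$r"
    using iter_ge_root_uniform[OF A diag path] by metis
  define q where "q = 1 - \<delta>"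
  have q: "0 \<le> q" "q < 1" using \<delta> by (auto simp: q_def)
  \<comment> \<open>One factor \<open>q\<close> for each completed block of \<open>N\<close> steps;
    the 2 arises because entries between \<open>-R\<close> and \<open>R\<close> have spread at most
    \<open>2 * R\<close>.\<close>
  define f where "f k = 2 * q ^ (k div N)" for k
  have contract: "\<exists>m M. M - m \<le> q ^ t * (2 * R) \<and>
      (\<forall>i. m \<le> iter A (t * N) x $ i \<and> iter A (t * N) x $ i \<le> M)"
    if R: "\<And>i. \<bar>x$i\<bar> \<le> R" for t x R
  proof (induction t)
    case 0
    have "- R \<le> x$i \<and> x$i \<le> R" for i using R[of i] by linarith
    then show ?case by (intro exI[of _ "-R"] exI[of _ R]) auto
  next
    case (Suc t)
    define y where "y = iter A (t * N) x"
    from Suc obtain m M where w: "M - m \<le> q ^ t * (2 * R)"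
      and y: "\<And>i. m \<le> y$i" "\<And>i. y$i \<le> M" by (auto simp: y_def)
    have S: "iter A (Suc t * N) x = iter A N y" by (simp add: y_def iter_add)
    \<comment> \<open>The root bound is applied to the nonnegative vectors \<open>y - m\<close> and
      \<open>M - y\<close>. The ends move inwards by \<open>\<delta> * (y$r - m)\<close> and
      \<open>\<delta> * (M - y$r)\<close>, together \<open>\<delta> * (M - m)\<close>, wherever
      \<open>y$r\<close> lies.\<close>
    have lo: "m + \<delta> * (y$r - m) \<le> iter A N y $ i" for i
      using root[of "y - (\<chi> i. m)" i] y by (simp add: iter_diff iter_const[OF A])
    have hi: "iter A N y $ i \<le> M - \<delta> * (M - y$r)" for i
      using root[of "(\<chi> i. M) - y" i] y by (simp add: iter_diff iter_const[OF A])
    have "(M - \<delta> * (M - y$r)) - (m + \<delta> * (y$r - m)) = q * (M - m)"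
      by (simp add: q_def algebra_simps)
    also have "\<dots> \<le> q * (q ^ t * (2 * R))" using w q by (intro mult_left_mono)
    finally show ?case unfolding S using lo hi
      by (intro exI[of _ "m + \<delta> * (y$r - m)"] exI[of _ "M - \<delta> * (M - y$r)"]) (simp add: mult.assoc)
  qed
  have div_top: "filterlim (\<lambda>k. k div N) at_top sequentially"
    using N by (rule filterlim_at_top_div_const_nat)
  have q0: "(\<lambda>n. q ^ n) \<longlonglongrightarrow> 0" using q by (intro LIMSEQ_power_zero) simp
  have nq0: "(\<lambda>n. real n * q ^ n) \<longlonglongrightarrow> 0" using q by (intro powser_times_n_limit_0) simp
  have f0: "f \<longlonglongrightarrow> 0"
    unfolding f_def using tendsto_mult_left[OF filterlim_compose[OF q0 div_top], of 2] by simp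
  have "(\<lambda>n. 2 * real N * (real n * q ^ n + q ^ n)) \<longlonglongrightarrow> 2 * real N * (0 + 0)"
    by (intro tendsto_intros q0 nq0)
  then have lim: "(\<lambda>k. 2 * real N * (real (k div N) * q ^ (k div N) + q ^ (k div N))) \<longlonglongrightarrow> 0"
    using filterlim_compose[OF _ div_top] by force
  \<comment> \<open>With \<open>n = k div N\<close>, \<open>k + 1\<close> is at most
    \<open>N * (n + 1)\<close>, so the extra factor is only linear in \<open>n\<close>, and
    \<open>q ^ n\<close> absorbs it.\<close>
  have le: "real (Suc k) * f k \<le> 2 * real N * (real (k div N) * q ^ (k div N) + q ^ (k div N))" for k
  proof -
    have "Suc k \<le> N * (k div N) + N"
      using N mod_less_divisor[of N k] mult_div_mod_eq[of N k] by linarith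
    then have "real (Suc k) \<le> real N * (real (k div N) + 1)"
      by (simp add: algebra_simps flip: of_nat_mult of_nat_add of_nat_Suc)
    then have "real (Suc k) * f k \<le> (real N * (real (k div N) + 1)) * f k"
      using q by (intro mult_right_mono) (auto simp: f_def)
    then show ?thesis by (simp add: f_def algebra_simps)
  qed
  have "(\<lambda>k. real (Suc k) * f k) \<longlonglongrightarrow> 0"
    by (rule tendsto_sandwich[OF _ _ tendsto_const lim])
      (use le q in \<open>auto simp: f_def intro!: always_eventually\<close>)
  then have kf0: "(\<lambda>k. real k * f (k - 1)) \<longlonglongrightarrow> 0"
    by (subst filterlim_sequentially_Suc[symmetric]) simp
  have bound: "\<bar>iter A k x $ i - iter A k x $ j\<bar> \<le> R * f k" if R: "\<And>i. \<bar>x$i\<bar> \<le> R" for x R k i j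
  proof -
    obtain m M where w: "M - m \<le> q ^ (k div N) * (2 * R)"
      and y: "\<And>i. m \<le> iter A (k div N * N) x $ i" "\<And>i. iter A (k div N * N) x $ i \<le> M"
      using contract[OF R, of "k div N"] by blast
    \<comment> \<open>The \<open>k mod N\<close> steps after the last full block need not shrink the
      interval, but they cannot leave it.\<close>
    have "iter A k x = iter A (k mod N) (iter A (k div N * N) x)"
      by (metis iter_add mod_div_mult_eq)
    then have "m \<le> iter A k x $ i" "iter A k x $ i \<le> M" for i
      using iter_between[OF A y, of "k mod N" i] by simp_all
    from this[of i] this[of j] show ?thesis using w by (simp add: f_def mult.commute mult.left_commute)
  qed
  show thesis using that f0 kf0 bound by blast
qed

text \<open>For \<open>k = 0\<close> the truncated \<open>k - 1\<close> is harmless because of the factor \<open>k\<close>.\<close>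

lemma double_iter_closed_form:
  fixes A :: "real^'p^'p"
  assumes "\<And>k. v (Suc k) = A *v v k" "\<And>k. y (Suc k) = A *v y k + \<tau> *\<^sub>R v k"
  shows "v k = iter A k (v 0)"
    and "y k = iter A k (y 0) + (real k * \<tau>) *\<^sub>R iter A (k - 1) (v 0)"
proof -
  show v: "v k = iter A k (v 0)" for k
    by (induction k) (simp_all add: iter_Suc assms)
  show "y k = iter A k (y 0) + (real k * \<tau>) *\<^sub>R iter A (k - 1) (v 0)"
  proof (induction k)
    case (Suc k)
    have "A *v ((real k * \<tau>) *\<^sub>R iter A (k - 1) (v 0)) = (real k * \<tau>) *\<^sub>R iter A k (v 0)"
      by (cases k) (simp_all add: iter_Suc matrix_vector_mult_scaleR)
    then show ?case
      using Suc by (simp add: assms(2) v[of k] iter_Suc matrix_vector_right_distrib distrib_right scaleR_add_left)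
  qed simp
qed

text \<open>The difference to the mean is the mean of the differences
  \<open>x$i - x$j\<close>.\<close>

lemma abs_diff_mean_le:
  fixes x :: "real^'p"
  assumes "\<And>i j. \<bar>x$i - x$j\<bar> \<le> B"
  shows "\<bar>x$i - (\<Sum>j\<in>UNIV. 1 / real CARD('p) * x$j)\<bar> \<le> B"
proof -
  have "x$i - (\<Sum>j\<in>UNIV. 1 / real CARD('p) * x$j)
      = (\<Sum>j\<in>UNIV. 1 / real CARD('p) * (x$i - x$j))"
    by (simp add: right_diff_distrib sum_subtractf)
  also have "\<bar>\<dots>\<bar> \<le> (\<Sum>j\<in>(UNIV::'p set). 1 / real CARD('p) * B)"
    using assms by (intro sum_norm_le[where 'a=real, simplified])
      (simp add: abs_mult divide_right_mono)
  finally show ?thesis by simp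
qed


section \<open>Endpoints of alpha-cuts\<close>

text \<open>The flag selects the upper endpoint, so that one proof serves both.\<close>

definition endpoint :: "bool \<Rightarrow> real \<Rightarrow> fuzzy \<Rightarrow> real" where
  "endpoint b \<alpha> x = (if b then Sup (alpha_cut x \<alpha>) else Inf (alpha_cut x \<alpha>))"

definition endpoints :: "bool \<Rightarrow> real \<Rightarrow> fuzzy^'m \<Rightarrow> real^'m" where
  "endpoints b \<alpha> x = (\<chi> i. endpoint b \<alpha> (x$i))"

text \<open>A nonempty compact convex subset of the line is a closed interval, so the two endpoints
  determine the cut.\<close>

lemma alpha_cut_eq_interval:
  assumes "\<alpha> \<in> {0..1}"
  shows "alpha_cut x \<alpha> = {endpoint False \<alpha> x..endpoint True \<alpha> x}"
    and "endpoint False \<alpha> x \<le> endpoint True \<alpha> x"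
proof -
  note ne = alpha_cut_nonempty[OF assms, of x]
  note co = alpha_cut_compact[OF assms, of x]
  have "connected (alpha_cut x \<alpha>)"
    using alpha_cut_convex[OF assms] by (rule convex_connected)
  then obtain a b where ab: "alpha_cut x \<alpha> = {a..b}"
    using connected_compact_interval_1[of "alpha_cut x \<alpha>"] co by auto
  then have "a \<le> b" using ne by simp
  then show "alpha_cut x \<alpha> = {endpoint False \<alpha> x..endpoint True \<alpha> x}"
    "endpoint False \<alpha> x \<le> endpoint True \<alpha> x"
    by (simp_all add: endpoint_def ab)
qed

text \<open>Every cut lies in the bounded cut at level 0, so one \<open>R\<close> covers all levels;
  the supremum in \<open>fuzzy_dist\<close> calls for this uniformity.\<close>

lemma endpoint_bounded:
  fixes x :: "fuzzy^'m"
  obtains R where "\<And>b \<alpha> i. \<alpha> \<in> {0..1} \<Longrightarrow> \<bar>endpoints b \<alpha> x $ i\<bar> \<le> R"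
proof -
  have "bounded (\<Union>i. alpha_cut (x$i) 0)"
    by (intro bounded_UN finite ballI compact_imp_bounded alpha_cut_compact) simp
  then obtain R where R: "\<And>i p. p \<in> alpha_cut (x$i) 0 \<Longrightarrow> \<bar>p\<bar> \<le> R"
    unfolding bounded_iff by auto
  have "\<bar>endpoints b \<alpha> x $ i\<bar> \<le> R" if "\<alpha> \<in> {0..1}" for b \<alpha> i
  proof -
    have "endpoint b \<alpha> (x$i) \<in> alpha_cut (x$i) \<alpha>"
      using alpha_cut_eq_interval[OF that, of "x$i"] by (cases b) auto
    then show ?thesis
      using R alpha_cut_antimono[of 0 \<alpha> "x$i"] that by (auto simp: endpoints_def)
  qed
  then show thesis using that by blast
qed

text \<open>With nonnegative coefficients the sum is nondecreasing in every \<open>z$j\<close>, so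
  it is extremal at the vectors of lower and of upper endpoints. A negative coefficient would
  exchange the two.\<close>

lemma endpoint_lincomb:
  assumes c: "\<And>j. c$j \<ge> 0" and \<alpha>: "\<alpha> \<in> {0..1}"
  shows "endpoint b \<alpha> (fuzzy_lincomb c x) = (\<Sum>j\<in>UNIV. c$j * endpoints b \<alpha> x $ j)"
proof -
  define s where "s b = (\<Sum>j\<in>UNIV. c$j * endpoints b \<alpha> x $ j)" for b
  note iv = alpha_cut_eq_interval[OF \<alpha>]
  have cut: "alpha_cut (fuzzy_lincomb c x) \<alpha> = lincomb_cut c x \<alpha>"
    using \<alpha> by (rule alpha_cut_fuzzy_lincomb)
  have "\<forall>j. endpoints b \<alpha> x $ j \<in> alpha_cut (x$j) \<alpha>" for b
    using iv by (cases b) (auto simp: endpoints_def)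
  then have "s b \<in> lincomb_cut c x \<alpha>" for b
    unfolding lincomb_cut_def s_def by blast
  then have sub: "s b \<in> {endpoint False \<alpha> (fuzzy_lincomb c x)..endpoint True \<alpha> (fuzzy_lincomb c x)}" for b
    using cut iv by blast
  have bd: "s False \<le> p \<and> p \<le> s True" if "p \<in> lincomb_cut c x \<alpha>" for p
    using that c unfolding lincomb_cut_def s_def
    by (auto simp: iv endpoints_def intro!: sum_mono mult_left_mono)
  have "endpoint b \<alpha> (fuzzy_lincomb c x) \<in> lincomb_cut c x \<alpha>" for b
    using iv[of "fuzzy_lincomb c x"] unfolding cut by (cases b) auto
  then have "endpoint b \<alpha> (fuzzy_lincomb c x) = s b"
    using bd sub[of True] sub[of False] by (cases b) (auto intro: antisym)
  then show ?thesis by (simp add: s_def)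
qed

lemma endpoints_mult:
  assumes "\<And>i j. M$i$j \<ge> 0" "\<alpha> \<in> {0..1}"
  shows "endpoints b \<alpha> (fuzzy_mult M x) = M *v endpoints b \<alpha> x"
proof -
  have "endpoint b \<alpha> (fuzzy_mult M x $ i) = (M *v endpoints b \<alpha> x) $ i" for i
    using assms by (simp add: fuzzy_mult_def endpoint_lincomb matrix_vector_mult_def)
  then show ?thesis by (simp add: endpoints_def vec_eq_iff)
qed

section \<open>From endpoint bounds to fuzzy distances\<close>

text \<open>The lower bound 0 needs an argument too: a real supremum is known to dominate the
  members only of a set bounded above, and \<open>R\<close> supplies that bound.\<close>

lemma hausdorff_dist_bounds:
  assumes "A \<noteq> {}" "B \<noteq> {}"
    and "\<And>a. a \<in> A \<Longrightarrow> \<exists>b\<in>B. dist a b \<le> R" "\<And>b. b \<in> B \<Longrightarrow> \<exists>a\<in>A. dist b a \<le> R"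
  shows "hausdorff_dist A B \<in> {0..R}"
proof -
  have inf: "infdist a B \<le> R" if "a \<in> A" for a
    using assms(3)[OF that] infdist_le2 by blast
  have inf': "infdist b A \<le> R" if "b \<in> B" for b
    using assms(4)[OF that] infdist_le2 by blast
  have le: "hausdorff_dist A B \<le> R"
    unfolding hausdorff_dist_def using assms(1,2) inf inf' by (auto intro!: cSUP_least)
  obtain a where "a \<in> A" using assms(1) by blast
  moreover have "bdd_above ((\<lambda>a. infdist a B) ` A)" using inf by (intro bdd_aboveI2) auto
  ultimately have "infdist a B \<le> (SUP a\<in>A. infdist a B)" by (rule cSUP_upper)
  then have "0 \<le> hausdorff_dist A B"
    unfolding hausdorff_dist_def using infdist_nonneg[of a B] by linarith
  then show ?thesis using le by simp
qed

lemma fuzzy_dist_bounds: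
  assumes "\<And>b \<alpha>. \<alpha> \<in> {0..1} \<Longrightarrow> \<bar>endpoint b \<alpha> x - endpoint b \<alpha> y\<bar> \<le> R"
  shows "fuzzy_dist x y \<in> {0..R}"
proof -
  \<comment> \<open>The witness is \<open>p\<close> clamped to the interval of \<open>y\<close>. If
    \<open>p\<close> lies beyond an end of it, the corresponding end for \<open>x\<close> lies at
    least as far out, but by at most \<open>R\<close>.\<close>
  have near: "\<exists>q\<in>alpha_cut y \<alpha>. dist p q \<le> R"
    if "\<alpha> \<in> {0..1}" "p \<in> alpha_cut x \<alpha>"
      "\<And>b. \<bar>endpoint b \<alpha> x - endpoint b \<alpha> y\<bar> \<le> R" for x y \<alpha> p
    using that(2) that(3)[of True] that(3)[of False] alpha_cut_eq_interval[OF that(1)]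
    by (intro bexI[of _ "max (endpoint False \<alpha> y) (min p (endpoint True \<alpha> y))"])
      (auto simp: dist_real_def)
  have h: "hausdorff_dist (alpha_cut x \<alpha>) (alpha_cut y \<alpha>) \<in> {0..R}" if "\<alpha> \<in> {0<..1}" for \<alpha>
  proof -
    have \<alpha>: "\<alpha> \<in> {0..1}" using that by simp
    show ?thesis
      using assms[OF \<alpha>]
      by (intro hausdorff_dist_bounds alpha_cut_nonempty near \<alpha>) (auto simp: abs_minus_commute)
  qed
  then have le: "fuzzy_dist x y \<le> R"
    unfolding fuzzy_dist_def by (intro cSUP_least) auto
  have "bdd_above ((\<lambda>\<alpha>. hausdorff_dist (alpha_cut x \<alpha>) (alpha_cut y \<alpha>)) ` {0<..1})"
    using h by (intro bdd_aboveI2) auto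
  then have "hausdorff_dist (alpha_cut x 1) (alpha_cut y 1) \<le> fuzzy_dist x y"
    unfolding fuzzy_dist_def by (intro cSUP_upper) auto
  then show ?thesis using h[of 1] le by simp
qed

lemma fuzzy_dist_tendsto_0:
  assumes "\<And>k b \<alpha>. \<alpha> \<in> {0..1} \<Longrightarrow> \<bar>endpoint b \<alpha> (x k) - endpoint b \<alpha> (y k)\<bar> \<le> g k"
    and "g \<longlonglongrightarrow> 0"
  shows "(\<lambda>k. fuzzy_dist (x k) (y k)) \<longlonglongrightarrow> 0"
proof (rule tendsto_sandwich[OF _ _ tendsto_const assms(2)])
  have "fuzzy_dist (x k) (y k) \<in> {0..g k}" for k
    by (rule fuzzy_dist_bounds) (rule assms(1))
  then show "\<forall>\<^sub>F k in sequentially. 0 \<le> fuzzy_dist (x k) (y k)"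
    "\<forall>\<^sub>F k in sequentially. fuzzy_dist (x k) (y k) \<le> g k" by simp_all
qed

section \<open>Block vectors\<close>

lemma stack_inject: "stack a b = stack c d \<longleftrightarrow> a = c \<and> b = d"
  by (auto simp: stack_def vec_eq_iff split: sum.splits)

lemma stack_nth [simp]: "stack a b $ Inl i = a$i" "stack a b $ Inr j = b$j"
  by (simp_all add: stack_def)

lemma sum_stack:
  fixes c a :: "real^'m" and d b :: "real^'n"
  shows "(\<Sum>s\<in>UNIV. stack c d $ s * stack a b $ s)
    = (\<Sum>i\<in>UNIV. c$i * a$i) + (\<Sum>j\<in>UNIV. d$j * b$j)"
  unfolding UNIV_Plus_UNIV[symmetric] by (subst sum.Plus) simp_all

lemma block_matrix_mult:
  fixes A :: "real^'m^'m" and D :: "real^'n^'n"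
  shows "block_matrix A B C D *v stack a b = stack (A *v a + B *v b) (C *v a + D *v b)"
proof -
  have "(block_matrix A B C D *v stack a b) $ s = stack (A *v a + B *v b) (C *v a + D *v b) $ s" for s
    by (cases s) (simp_all add: matrix_vector_mult_def block_matrix_def sum_stack)
  then show ?thesis by (simp add: vec_eq_iff)
qed

lemma endpoints_stack: "endpoints b \<alpha> (stack y v) = stack (endpoints b \<alpha> y) (endpoints b \<alpha> v)"
  by (auto simp: vec_eq_iff endpoints_def stack_def split: sum.splits)

lemma fuzzy_average_endpoint:
  fixes x :: "fuzzy^'p"
  assumes "\<alpha> \<in> {0..1}"
  shows "endpoint b \<alpha> (fuzzy_average x) = (\<Sum>j\<in>UNIV. 1 / real CARD('p) * endpoints b \<alpha> x $ j)"
  unfolding fuzzy_average_def by (subst endpoint_lincomb) (use assms in auto)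

text \<open>\<open>t \<ge> 0\<close> keeps all coefficients nonnegative, so the same endpoint of
  every entry of \<open>y\<close> and \<open>v\<close> enters.\<close>

lemma fuzzy_drift_average_endpoint:
  fixes y v :: "fuzzy^'p"
  assumes "\<alpha> \<in> {0..1}" "t \<ge> 0"
  shows "endpoint b \<alpha> (fuzzy_drift_average t y v)
    = (\<Sum>j\<in>UNIV. 1 / real CARD('p) * endpoints b \<alpha> y $ j)
      + t * (\<Sum>j\<in>UNIV. 1 / real CARD('p) * endpoints b \<alpha> v $ j)"
proof -
  have "endpoint b \<alpha> (fuzzy_drift_average t y v)
    = (\<Sum>s\<in>UNIV. stack (\<chi> j. 1 / real CARD('p)) (\<chi> j. t * (1 / real CARD('p))) $ s *
         endpoints b \<alpha> (stack y v) $ s)"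
    unfolding fuzzy_drift_average_def using assms
    by (intro endpoint_lincomb) (auto simp: stack_def split: sum.splits)
  then show ?thesis
    unfolding endpoints_stack sum_stack by (simp add: sum_distrib_left mult.assoc)
qed


section \<open>The closed loop\<close>

lemma single_loop_nth:
  "single_loop_matrix \<tau> \<Gamma> $ i $ j =
    (if i = j then 1 - \<tau> * (\<Sum>k\<in>UNIV. \<Gamma>$i$k) else \<tau> * \<Gamma>$i$j)"
  by (simp add: single_loop_matrix_def laplacian_def mat_def)

text \<open>The vanishing \<open>g i\<close> mirrors the zero diagonal of \<open>\<Gamma>\<close>: a
  row or column of the loop matrix splits into its diagonal part and a full sum of weights.\<close>

lemma sum_update_diagonal:
  fixes g :: "'p::finite \<Rightarrow> real"
  assumes "g i = 0"
  shows "(\<Sum>j\<in>UNIV. if i = j then c else g j) = c + (\<Sum>j\<in>UNIV. g j)"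
proof -
  have "(\<Sum>j\<in>UNIV. if i = j then c else g j) = (\<Sum>j\<in>UNIV. (if i = j then c else 0) + g j)"
    using assms by (intro sum.cong) auto
  then show ?thesis by (simp add: sum.distrib)
qed

lemma single_loop_row_sum:
  assumes "adjacency_matrix \<Gamma>"
  shows "(\<Sum>j\<in>UNIV. single_loop_matrix \<tau> \<Gamma> $ i $ j) = 1"
  unfolding single_loop_nth using assms
  by (subst sum_update_diagonal) (auto simp: adjacency_matrix_def sum_distrib_left)

text \<open>Column \<open>j\<close> sums to 1 minus \<tau> times the out-degree plus \<tau> times
  the in-degree of node \<open>j\<close>, and balance equates the two.\<close>

lemma single_loop_column_sum:
  assumes "adjacency_matrix \<Gamma>" "balanced \<Gamma>"
  shows "(\<Sum>i\<in>UNIV. single_loop_matrix \<tau> \<Gamma> $ i $ j) = 1"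
proof -
  have "(\<Sum>i\<in>UNIV. single_loop_matrix \<tau> \<Gamma> $ i $ j)
      = (\<Sum>i\<in>UNIV. if j = i then 1 - \<tau> * (\<Sum>k\<in>UNIV. \<Gamma>$j$k) else \<tau> * \<Gamma>$i$j)"
    by (intro sum.cong) (auto simp: single_loop_nth)
  also have "\<dots> = 1"
    using assms
    by (subst sum_update_diagonal) (auto simp: adjacency_matrix_def balanced_def sum_distrib_left)
  finally show ?thesis .
qed

text \<open>The entry is 1 minus \<tau> times a diagonal entry of the Laplacian, which is at most
  the maximum \<open>l\<close>. If \<open>l \<le> 0\<close>, then \<open>\<tau> * l \<le> 0\<close>
  at once.\<close>

lemma single_loop_diagonal_pos:
  fixes \<Gamma> :: "real^'p^'p"
  assumes "\<tau> > 0"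
    and "max_diagonal (laplacian \<Gamma>) > 0 \<longrightarrow> \<tau> < 1 / max_diagonal (laplacian \<Gamma>)"
  shows "single_loop_matrix \<tau> \<Gamma> $ i $ i > 0"
proof -
  define l where "l = max_diagonal (laplacian \<Gamma>)"
  have "laplacian \<Gamma> $ i $ i \<le> l"
    unfolding l_def max_diagonal_def by (intro Max_ge) auto
  then have "\<tau> * laplacian \<Gamma> $ i $ i \<le> \<tau> * l" using assms(1) by simp
  also have "\<tau> * l < 1"
  proof (cases "l > 0")
    case True
    then show ?thesis using assms(2) by (simp add: l_def[symmetric] field_simps)
  next
    case False
    then have "\<tau> * l \<le> 0" using assms(1) by (simp add: mult_nonneg_nonpos)
    then show ?thesis by simp
  qed
  finally show ?thesis by (simp add: single_loop_nth laplacian_def)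
qed

lemma single_loop_nonneg:
  assumes "adjacency_matrix \<Gamma>" "\<tau> > 0" "\<And>i. single_loop_matrix \<tau> \<Gamma> $ i $ i > 0"
  shows "single_loop_matrix \<tau> \<Gamma> $ i $ j \<ge> 0"
  using assms(3)[of i] assms(1,2) by (auto simp: single_loop_nth adjacency_matrix_def)

text \<open>As \<open>\<Gamma>\<close> has zero diagonal, arcs occupy off-diagonal entries, where
  the loop matrix is \<open>\<tau> * \<Gamma>$i$j\<close>. This transfers the paths of the tree to
  the loop matrix.\<close>

lemma edges_subset_single_loop:
  assumes "adjacency_matrix \<Gamma>" "\<tau> > 0"
  shows "edges \<Gamma> \<subseteq> {(i, j). single_loop_matrix \<tau> \<Gamma> $ i $ j > 0}"
  using assms by (auto simp: edges_def single_loop_nth adjacency_matrix_def)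

lemma consensus_protocol_eq_sum:
  assumes "adjacency_matrix \<Gamma>"
  shows "consensus_protocol \<Gamma> y $ i = (\<Sum>j\<in>UNIV. \<Gamma>$i$j * (y$j - y$i))"
  unfolding consensus_protocol_def vec_lambda_beta
  using assms
  by (intro sum.mono_neutral_left) (auto simp: neighbours_def edges_def adjacency_matrix_def not_less order.antisym)

text \<open>Collecting the coefficient of \<open>y$i\<close> gives the diagonal entry. The left side
  is written out so that it also serves both components of the double integrator.\<close>

lemma integrator_closed_loop:
  assumes "adjacency_matrix \<Gamma>"
  shows "(\<chi> i. y$i + \<tau> * consensus_protocol \<Gamma> y $ i) = single_loop_matrix \<tau> \<Gamma> *v y"
proof -
  have "(single_loop_matrix \<tau> \<Gamma> *v y) $ i = y$i + \<tau> * consensus_protocol \<Gamma> y $ i" for i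
  proof -
    have "(single_loop_matrix \<tau> \<Gamma> *v y) $ i
      = (\<Sum>j\<in>UNIV. if i = j then (1 - \<tau> * (\<Sum>k\<in>UNIV. \<Gamma>$i$k)) * y$i else \<tau> * \<Gamma>$i$j * y$j)"
      unfolding matrix_vector_mult_def vec_lambda_beta
      by (intro sum.cong) (auto simp: single_loop_nth)
    also have "\<dots> = y$i + \<tau> * consensus_protocol \<Gamma> y $ i"
      using assms
      by (subst sum_update_diagonal)
        (auto simp: adjacency_matrix_def consensus_protocol_eq_sum[OF assms] algebra_simps
          sum_subtractf sum_distrib_left sum_distrib_right)
    finally show ?thesis .
  qed
  then show ?thesis by (simp add: vec_eq_iff)
qed

lemma scaleR_mat_mult: "(\<tau> *\<^sub>R mat 1) *v x = \<tau> *\<^sub>R (x :: real^'p)"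
  by (simp flip: scaleR_matrix_vector_assoc)

lemma double_loop_mult_stack:
  "double_loop_matrix \<tau> \<Gamma> *v stack y v =
    stack (single_loop_matrix \<tau> \<Gamma> *v y + \<tau> *\<^sub>R v) (single_loop_matrix \<tau> \<Gamma> *v v)"
  unfolding double_loop_matrix_def block_matrix_mult scaleR_mat_mult
  by (simp add: single_loop_matrix_def)

lemma double_loop_nonneg:
  fixes \<Gamma> :: "real^'p^'p"
  assumes "\<And>i j. single_loop_matrix \<tau> \<Gamma> $ i $ j \<ge> 0" "\<tau> > 0"
  shows "double_loop_matrix \<tau> \<Gamma> $ s $ t \<ge> 0"
  using assms unfolding double_loop_matrix_def block_matrix_def single_loop_matrix_def
  by (auto simp: stack_def mat_def split: sum.splits)

text \<open>The bound on \<tau> is guarded because \<open>1 / 0 = 0\<close> in HOL: for a single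
  node the maximum is 0, and an unguarded bound would contradict \<open>\<tau> > 0\<close>. The
  crisp identities justify the matrices that drive the fuzzy recursions.\<close>

theorem mainTheorem4:
  fixes \<Gamma> :: "real^'p^'p" and \<tau> :: real
  assumes "adjacency_matrix \<Gamma>"
    and "unitary_weights \<Gamma>"
    and "has_directed_spanning_tree \<Gamma>"
    and "\<tau> > 0"
    and "max_diagonal (laplacian \<Gamma>) > 0 \<longrightarrow> \<tau> < 1 / max_diagonal (laplacian \<Gamma>)"
  shows
    \<comment> \<open>single integrators\<close>
    "((\<forall>y. single_integrator \<tau> y (consensus_protocol \<Gamma> y) = single_loop_matrix \<tau> \<Gamma> *v y) \<and>
      (\<forall>(y0 :: fuzzy^'p) y.
         y 0 = y0 \<and> (\<forall>k. y (Suc k) = fuzzy_mult (single_loop_matrix \<tau> \<Gamma>) (y k)) \<longrightarrow>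
         (\<forall>i j. (\<lambda>k. fuzzy_dist (y k $ i) (y k $ j)) \<longlonglongrightarrow> 0) \<and>
         (strongly_connected \<Gamma> \<and> balanced \<Gamma> \<longrightarrow>
           (\<forall>i. (\<lambda>k. fuzzy_dist (y k $ i) (fuzzy_average y0)) \<longlonglongrightarrow> 0)))) \<and>
     \<comment> \<open>double integrators\<close>
     ((\<forall>y v. double_integrator \<tau> y v (consensus_protocol \<Gamma> y) (consensus_protocol \<Gamma> v)
         = double_loop_matrix \<tau> \<Gamma> *v stack y v) \<and>
      (\<forall>(y0 :: fuzzy^'p) (v0 :: fuzzy^'p) y v.
         y 0 = y0 \<and> v 0 = v0 \<and>
         (\<forall>k. stack (y (Suc k)) (v (Suc k))
              = fuzzy_mult (double_loop_matrix \<tau> \<Gamma>) (stack (y k) (v k))) \<longrightarrow>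
         (\<forall>i j. (\<lambda>k. fuzzy_dist (y k $ i) (y k $ j) + fuzzy_dist (v k $ i) (v k $ j)) \<longlonglongrightarrow> 0) \<and>
         (strongly_connected \<Gamma> \<and> balanced \<Gamma> \<longrightarrow>
           (\<forall>i. (\<lambda>k. fuzzy_dist (v k $ i) (fuzzy_average v0)) \<longlonglongrightarrow> 0) \<and>
           (\<forall>i. (\<lambda>k. fuzzy_dist (y k $ i) (fuzzy_drift_average (real k * \<tau>) y0 v0))
                  \<longlonglongrightarrow> 0))))"
proof -
  define A where "A = single_loop_matrix \<tau> \<Gamma>"
  note adj = assms(1) and \<tau> = assms(4)
  have diag: "A$i$i > 0" for i
    unfolding A_def by (rule single_loop_diagonal_pos[OF assms(4,5)])
  have nonneg: "A$i$j \<ge> 0" for i j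
    using single_loop_nonneg[OF adj \<tau>] diag by (simp add: A_def)
  have A: "row_stochastic A"
    using nonneg single_loop_row_sum[OF adj, of \<tau>] by (simp add: row_stochastic_def A_def)
  obtain r T where "T \<subseteq> edges \<Gamma>" "\<And>i. (i, r) \<in> T\<^sup>*"
    using assms(3) by (auto simp: has_directed_spanning_tree_def spanning_tree_at_def)
  then have path: "(i, r) \<in> {(i, j). A$i$j > 0}\<^sup>*" for i
    using edges_subset_single_loop[OF adj \<tau>] rtrancl_mono[of T "{(i, j). A$i$j > 0}"]
    unfolding A_def by blast
  obtain f where f0: "f \<longlonglongrightarrow> 0" and kf0: "(\<lambda>k. real k * f (k - 1)) \<longlonglongrightarrow> 0"
    and spread: "\<And>x R k i j. (\<And>i. \<bar>x$i\<bar> \<le> R) \<Longrightarrow> \<bar>iter A k x $ i - iter A k x $ j\<bar> \<le> R * f k"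
    using iter_spread_tendsto_0[OF A diag path] by metis
  \<comment> \<open>Balance keeps the sum fixed, so the mean of \<open>x\<close> is the mean of
    \<open>iter A k x\<close>, and no entry is further from that mean than the spread.\<close>
  have mean: "\<bar>iter A k x $ i - (\<Sum>j\<in>UNIV. 1 / real CARD('p) * x$j)\<bar> \<le> R * f k"
    if bal: "balanced \<Gamma>" and R: "\<And>i. \<bar>x$i\<bar> \<le> R" for x R k i
  proof -
    have "(\<Sum>j\<in>UNIV. iter A k x $ j) = (\<Sum>j\<in>UNIV. x$j)"
      using single_loop_column_sum[OF adj bal] by (intro sum_iter_column_stochastic) (simp add: A_def)
    then have "(\<Sum>j\<in>UNIV. 1 / real CARD('p) * x$j) = (\<Sum>j\<in>UNIV. 1 / real CARD('p) * iter A k x $ j)"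
      by (simp flip: sum_distrib_left sum_divide_distrib)
    then show ?thesis
      using abs_diff_mean_le[of "iter A k x" "R * f k" i] spread[OF R] by simp
  qed

  have single_loop: "single_integrator \<tau> y (consensus_protocol \<Gamma> y) = single_loop_matrix \<tau> \<Gamma> *v y"
    for y
    unfolding single_integrator_def by (rule integrator_closed_loop[OF adj])
  have double_loop: "double_integrator \<tau> y v (consensus_protocol \<Gamma> y) (consensus_protocol \<Gamma> v)
      = double_loop_matrix \<tau> \<Gamma> *v stack y v" for y v
    unfolding double_integrator_def double_loop_mult_stack stack_inject
    using integrator_closed_loop[OF adj, of y \<tau>] integrator_closed_loop[OF adj, of v \<tau>]
    by (auto simp: vec_eq_iff algebra_simps)

  \<comment> \<open>Assuming only the endpoint recursion, rather than \<open>fuzzy_mult\<close>,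
    makes the result apply to \<open>v\<close> in the double loop as well.\<close>
  have single: "(\<forall>i j. (\<lambda>k. fuzzy_dist (y k $ i) (y k $ j)) \<longlonglongrightarrow> 0) \<and>
      (balanced \<Gamma> \<longrightarrow> (\<forall>i. (\<lambda>k. fuzzy_dist (y k $ i) (fuzzy_average (y 0))) \<longlonglongrightarrow> 0))"
    if rec: "\<And>k b \<alpha>. \<alpha> \<in> {0..1} \<Longrightarrow> endpoints b \<alpha> (y (Suc k)) = A *v endpoints b \<alpha> (y k)"
    for y :: "nat \<Rightarrow> fuzzy^'p"
  proof -
    have e: "endpoint b \<alpha> (y k $ i) = iter A k (endpoints b \<alpha> (y 0)) $ i"
      if "\<alpha> \<in> {0..1}" for b \<alpha> k i
    proof -
      have "endpoints b \<alpha> (y k) = iter A k (endpoints b \<alpha> (y 0))"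
        by (induction k) (simp_all add: iter_Suc rec[OF that])
      then show ?thesis by (simp add: endpoints_def vec_eq_iff)
    qed
    obtain R where R: "\<And>b \<alpha> i. \<alpha> \<in> {0..1} \<Longrightarrow> \<bar>endpoints b \<alpha> (y 0) $ i\<bar> \<le> R"
      using endpoint_bounded[of "y 0"] by blast
    have lim: "(\<lambda>k. R * f k) \<longlonglongrightarrow> 0" using tendsto_mult_left[OF f0, of R] by simp
    have "(\<lambda>k. fuzzy_dist (y k $ i) (y k $ j)) \<longlonglongrightarrow> 0" for i j
      by (rule fuzzy_dist_tendsto_0[OF _ lim]) (simp add: e spread R)
    moreover have "(\<lambda>k. fuzzy_dist (y k $ i) (fuzzy_average (y 0))) \<longlonglongrightarrow> 0" if "balanced \<Gamma>" for i
      by (rule fuzzy_dist_tendsto_0[OF _ lim])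
        (simp only: e fuzzy_average_endpoint, rule mean[OF that R])
    ultimately show ?thesis by blast
  qed

  have double: "(\<forall>i j. (\<lambda>k. fuzzy_dist (y k $ i) (y k $ j) + fuzzy_dist (v k $ i) (v k $ j)) \<longlonglongrightarrow> 0) \<and>
      (balanced \<Gamma> \<longrightarrow>
        (\<forall>i. (\<lambda>k. fuzzy_dist (v k $ i) (fuzzy_average (v 0))) \<longlonglongrightarrow> 0) \<and>
        (\<forall>i. (\<lambda>k. fuzzy_dist (y k $ i) (fuzzy_drift_average (real k * \<tau>) (y 0) (v 0))) \<longlonglongrightarrow> 0))"
    if loop: "\<And>k. stack (y (Suc k)) (v (Suc k)) = fuzzy_mult (double_loop_matrix \<tau> \<Gamma>) (stack (y k) (v k))"
    for y v :: "nat \<Rightarrow> fuzzy^'p"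
  proof -
    have dn: "double_loop_matrix \<tau> \<Gamma> $ s $ t \<ge> 0" for s t
      using nonneg unfolding A_def by (intro double_loop_nonneg \<tau>)
    have "stack (endpoints b \<alpha> (y (Suc k))) (endpoints b \<alpha> (v (Suc k)))
        = stack (A *v endpoints b \<alpha> (y k) + \<tau> *\<^sub>R endpoints b \<alpha> (v k)) (A *v endpoints b \<alpha> (v k))"
      if "\<alpha> \<in> {0..1}" for b \<alpha> k
      using endpoints_mult[OF dn that, of b "stack (y k) (v k)"]
      unfolding loop[symmetric] endpoints_stack double_loop_mult_stack A_def .
    then have rec_y: "endpoints b \<alpha> (y (Suc k)) = A *v endpoints b \<alpha> (y k) + \<tau> *\<^sub>R endpoints b \<alpha> (v k)"
      and rec_v: "endpoints b \<alpha> (v (Suc k)) = A *v endpoints b \<alpha> (v k)"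
      if "\<alpha> \<in> {0..1}" for b \<alpha> k
      using that by (simp_all add: stack_inject)
    have e: "endpoint b \<alpha> (y k $ i) = iter A k (endpoints b \<alpha> (y 0)) $ i
        + (real k * \<tau>) * iter A (k - 1) (endpoints b \<alpha> (v 0)) $ i"
      if "\<alpha> \<in> {0..1}" for b \<alpha> k i
    proof -
      have "endpoints b \<alpha> (y k) = iter A k (endpoints b \<alpha> (y 0))
          + (real k * \<tau>) *\<^sub>R iter A (k - 1) (endpoints b \<alpha> (v 0))"
        by (rule double_iter_closed_form(2)[where v = "\<lambda>k. endpoints b \<alpha> (v k)"
              and y = "\<lambda>k. endpoints b \<alpha> (y k)"]) (use rec_y rec_v that in auto)
      then show ?thesis by (simp add: endpoints_def vec_eq_iff)
    qed
    obtain R where R: "\<And>b \<alpha> i. \<alpha> \<in> {0..1} \<Longrightarrow> \<bar>endpoints b \<alpha> (y 0) $ i\<bar> \<le> R"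
      using endpoint_bounded[of "y 0"] by blast
    obtain S where S: "\<And>b \<alpha> i. \<alpha> \<in> {0..1} \<Longrightarrow> \<bar>endpoints b \<alpha> (v 0) $ i\<bar> \<le> S"
      using endpoint_bounded[of "v 0"] by blast
    \<comment> \<open>By the closed form, the first term bounds the spread due to \<open>y 0\<close>
      and the second the spread of the drift due to \<open>v 0\<close>.\<close>
    define g where "g k = R * f k + (real k * \<tau>) * (S * f (k - 1))" for k
    have "(\<lambda>k. R * f k + \<tau> * S * (real k * f (k - 1))) \<longlonglongrightarrow> R * 0 + \<tau> * S * 0"
      by (intro tendsto_intros f0 kf0)
    then have lim: "g \<longlonglongrightarrow> 0" by (simp add: g_def[abs_def] mult_ac)
    \<comment> \<open>One estimate for two uses: \<open>p'\<close> and \<open>q'\<close> are either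
      the values at another node or the means of the initial endpoints.\<close>
    have combine: "\<bar>(p + real k * \<tau> * q) - (p' + real k * \<tau> * q')\<bar> \<le> g k"
      if "\<bar>p - p'\<bar> \<le> R * f k" "\<bar>q - q'\<bar> \<le> S * f (k - 1)" for p q p' q' :: real and k
    proof -
      have "\<bar>real k * \<tau> * (q - q')\<bar> \<le> real k * \<tau> * (S * f (k - 1))"
        using \<tau> that(2) by (simp add: abs_mult mult_left_mono)
      moreover have "(p + real k * \<tau> * q) - (p' + real k * \<tau> * q') = (p - p') + real k * \<tau> * (q - q')"
        by (simp add: algebra_simps)
      ultimately show ?thesis using that(1) unfolding g_def by linarith
    qed
    have y: "(\<lambda>k. fuzzy_dist (y k $ i) (y k $ j)) \<longlonglongrightarrow> 0" for i j
      by (rule fuzzy_dist_tendsto_0[OF _ lim])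
        (simp only: e, intro combine spread R S)
    \<comment> \<open>The target moves with \<open>k\<close>, but the drift is compared with
      \<open>real k * \<tau>\<close> times the mean of the initial \<open>v\<close>, so the same
      \<open>g\<close> bounds the distance.\<close>
    have y_avg: "(\<lambda>k. fuzzy_dist (y k $ i) (fuzzy_drift_average (real k * \<tau>) (y 0) (v 0))) \<longlonglongrightarrow> 0"
      if "balanced \<Gamma>" for i
    proof (rule fuzzy_dist_tendsto_0[OF _ lim])
      fix k b and \<alpha> :: real assume \<alpha>: "\<alpha> \<in> {0..1}"
      have "real k * \<tau> \<ge> 0" using \<tau> by simp
      then show "\<bar>endpoint b \<alpha> (y k $ i)
          - endpoint b \<alpha> (fuzzy_drift_average (real k * \<tau>) (y 0) (v 0))\<bar> \<le> g k"
        unfolding e[OF \<alpha>] fuzzy_drift_average_endpoint[OF \<alpha> \<open>real k * \<tau> \<ge> 0\<close>]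
        by (intro combine mean that R S \<alpha>)
    qed
    from y single[of v] rec_v y_avg show ?thesis
      by (auto intro: tendsto_add_zero)
  qed
  have single_rec: "endpoints b \<alpha> (fuzzy_mult (single_loop_matrix \<tau> \<Gamma>) x) = A *v endpoints b \<alpha> x"
    if "\<alpha> \<in> {0..1}" for b \<alpha> x
    using endpoints_mult[OF nonneg that] unfolding A_def .
  have single': "(\<forall>i j. (\<lambda>k. fuzzy_dist (y k $ i) (y k $ j)) \<longlonglongrightarrow> 0) \<and>
      (strongly_connected \<Gamma> \<and> balanced \<Gamma> \<longrightarrow>
        (\<forall>i. (\<lambda>k. fuzzy_dist (y k $ i) (fuzzy_average y0)) \<longlonglongrightarrow> 0))"
    if y: "y 0 = y0 \<and> (\<forall>k. y (Suc k) = fuzzy_mult (single_loop_matrix \<tau> \<Gamma>) (y k))"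
    for y0 :: "fuzzy^'p" and y
  proof -
    have "endpoints b \<alpha> (y (Suc k)) = A *v endpoints b \<alpha> (y k)" if "\<alpha> \<in> {0..1}" for b \<alpha> k
      using y single_rec[OF that] by simp
    then have "(\<forall>i j. (\<lambda>k. fuzzy_dist (y k $ i) (y k $ j)) \<longlonglongrightarrow> 0) \<and>
      (balanced \<Gamma> \<longrightarrow> (\<forall>i. (\<lambda>k. fuzzy_dist (y k $ i) (fuzzy_average (y 0))) \<longlonglongrightarrow> 0))"
      by (rule single)
    then show ?thesis using y by simp
  qed
  have double': "(\<forall>i j. (\<lambda>k. fuzzy_dist (y k $ i) (y k $ j) + fuzzy_dist (v k $ i) (v k $ j)) \<longlonglongrightarrow> 0) \<and>
      (strongly_connected \<Gamma> \<and> balanced \<Gamma> \<longrightarrow>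
        (\<forall>i. (\<lambda>k. fuzzy_dist (v k $ i) (fuzzy_average v0)) \<longlonglongrightarrow> 0) \<and>
        (\<forall>i. (\<lambda>k. fuzzy_dist (y k $ i) (fuzzy_drift_average (real k * \<tau>) y0 v0)) \<longlonglongrightarrow> 0))"
    if "y 0 = y0 \<and> v 0 = v0 \<and> (\<forall>k. stack (y (Suc k)) (v (Suc k))
          = fuzzy_mult (double_loop_matrix \<tau> \<Gamma>) (stack (y k) (v k)))"
    for y0 v0 :: "fuzzy^'p" and y v
    using double[of y v] that by simp
  show ?thesis
    by (rule conjI; rule conjI; (rule allI)+;
        (rule single_loop double_loop | (rule impI, erule single' double')))
qed

end
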